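(* Let $0<q<1$, $0<a<q^{-1}$, $0<b<q^{-1}$, $c<0$ and $n\in\mathbb{N}$. Then for all $x$, $$\sum_{k=0}^n\frac{(q^{-n},x;q)_k}{(q,aq,cq;q)_k}(-abq^n)^kq^{\frac12k^2+\frac32k}\,P_{n-k}(xq^k;aq^k,0,cq^k;q)=P_n(x;a,b,c;q).$$
   Context: $\mathbb N=\{0,1,2,\dots\}$. $(y;q)_k=\prod_{j=0}^{k-1}(1-yq^j)$ and $(y_1,\dots,y_r;q)_k=\prod_i(y_i;q)_k$. The big $q$-Jacobi polynomials are $$P_n(x;a,b,c;q)=\sum_{j=0}^n\frac{(q^{-n},abq^{n+1},x;q)_j}{(aq,cq,q;q)_j}q^j;$$ the case $b=0$ gives the big $q$-Laguerre polynomials. *)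

theory Defs
  imports Complex_Main
begin

definition qpoch :: "'a::field \<Rightarrow> 'a \<Rightarrow> nat \<Rightarrow> 'a" where
  "qpoch y q k = (\<Prod>j<k. 1 - y * q ^ j)"

definition qpochs :: "'a::field list \<Rightarrow> 'a \<Rightarrow> nat \<Rightarrow> 'a" where
  "qpochs ys q k = (\<Prod>y\<leftarrow>ys. qpoch y q k)"

text \<open>
  The parameters come in the order \<open>P\<^sub>n(x; a, b, c; q)\<close>. Division by zero yields zero here, so the
  formula is meaningful only if \<open>(aq, cq, q; q)\<^sub>j\<close> does not vanish for any \<open>j \<le> n\<close>.
\<close>

definition big_q_jacobi :: "nat \<Rightarrow> 'a::field \<Rightarrow> 'a \<Rightarrow> 'a \<Rightarrow> 'a \<Rightarrow> 'a \<Rightarrow> 'a" where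
  "big_q_jacobi n x a b c q =
     (\<Sum>j = 0..n. qpochs [q powi (- int n), a * b * q ^ (n + 1), x] q j
                 / qpochs [a * q, c * q, q] q j * q ^ j)"

end

theory Submission
  imports Defs
begin

text \<open>
  The identity is the \<open>q\<close>-binomial theorem in disguise. Since \<open>(0; q)\<^sub>i = 1\<close>, and since shifting
  \<open>u\<close> to \<open>u q\<^sup>k\<close> makes \<open>(u; q)\<^sub>k (u q\<^sup>k; q)\<^sub>i = (u; q)\<^bsub>k + i\<^esub>\<close>, the factors belonging to
  \<open>q\<close> to the power \<open>-n\<close>, to \<open>x\<close>, to \<open>a q\<close> and to \<open>c q\<close> in the double sum on the left depend only on
  \<open>j = k + i\<close> (lemma \<open>qpoch_add\<close>). What is left to sum over \<open>k + i = j\<close> is \<open>q\<^sup>j\<close> times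
  \<open>(-z)\<^sup>k q\<^bsup>k(k-1)/2\<^esup> / ((q; q)\<^sub>k (q; q)\<^sub>i)\<close> with \<open>z = a b q\<^bsup>n+1\<^esup>\<close>, and this is
  \<open>q\<^sup>j (z; q)\<^sub>j / (q; q)\<^sub>j\<close> by the \<open>q\<close>-binomial theorem (lemma \<open>q_binomial\<close>): exactly the factor
  that distinguishes big \<open>q\<close>-Jacobi from big \<open>q\<close>-Laguerre polynomials.

  The argument is algebraic and works over every field as long as \<open>q\<close> is nonzero and not a root of
  unity (lemma \<open>big_q_jacobi_as_laguerre_sum\<close>). Vanishing of \<open>(a q, c q; q)\<^sub>j\<close> does no harm
  because \<open>inverse\<close> is multiplicative even at zero.
\<close>

lemma qpoch_0 [simp]: "qpoch y q 0 = 1"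
  by (simp add: qpoch_def)

lemma qpoch_Suc: "qpoch y q (Suc k) = qpoch y q k * (1 - y * q ^ k)"
  by (simp add: qpoch_def)

lemma qpoch_zero_left [simp]: "qpoch 0 q k = 1"
  by (simp add: qpoch_def)

lemma qpoch_add: "qpoch y q (k + i) = qpoch y q k * qpoch (y * q ^ k) q i"
  by (induction i) (simp_all add: qpoch_Suc power_add mult.assoc)

lemma qpoch_self_nonzero:
  assumes "\<And>m. m > 0 \<Longrightarrow> q ^ m \<noteq> 1"
  shows "qpoch q q k \<noteq> 0"
  using assms[of "Suc _"] by (auto simp: qpoch_def)

text \<open>
  The induction rests on the \<open>q\<close>-Pascal rule, in the form
  \<open>1 - q\<^bsup>k+i\<^esup> = (1 - q\<^sup>i) + q\<^sup>i (1 - q\<^sup>k)\<close>: the first part lowers \<open>i\<close> by one and the second lowers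
  \<open>k\<close> by one, so \<open>1 - q\<^bsup>j+1\<^esup>\<close> times the sum for \<open>j + 1\<close> is \<open>1 - z q\<^sup>j\<close> times the sum for \<open>j\<close>.
\<close>

lemma q_binomial:
  fixes q z :: "'a::field"
  assumes not_root: "\<And>m. m > 0 \<Longrightarrow> q ^ m \<noteq> 1"
  shows "(\<Sum>k\<le>j. (- z) ^ k * q ^ (k choose 2) / (qpoch q q k * qpoch q q (j - k)))
         = qpoch z q j / qpoch q q j"
proof (induction j)
  case 0
  show ?case by (simp add: binomial_eq_0)
next
  case (Suc j)
  define t where "t k i = (- z) ^ k * q ^ (k choose 2) / (qpoch q q k * qpoch q q i)" for k i
  have nz: "1 - q * q ^ m \<noteq> 0" for m
    using not_root[of "Suc m"] by simp
  have lower_i: "(1 - q ^ Suc i) * t k (Suc i) = t k i" for k i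
    using nz[of i] by (simp add: t_def qpoch_Suc)
  have lower_k: "(1 - q ^ Suc k) * t (Suc k) i = - z * q ^ k * t k i" for k i
    using nz[of k] by (simp add: t_def qpoch_Suc numeral_2_eq_2 power_add)
  have "(1 - q ^ Suc j) * (\<Sum>k\<le>Suc j. t k (Suc j - k))
      = (\<Sum>k\<le>Suc j. (1 - q ^ (Suc j - k)) * t k (Suc j - k)
                    + q ^ (Suc j - k) * ((1 - q ^ k) * t k (Suc j - k)))"
    unfolding sum_distrib_left
  proof (rule sum.cong)
    fix k assume "k \<in> {..Suc j}"
    then have "q ^ Suc j = q ^ (Suc j - k) * q ^ k"
      by (simp flip: power_add)
    then show "(1 - q ^ Suc j) * t k (Suc j - k)
        = (1 - q ^ (Suc j - k)) * t k (Suc j - k)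
          + q ^ (Suc j - k) * ((1 - q ^ k) * t k (Suc j - k))"
      by (simp only:) (simp add: algebra_simps)
  qed simp
  also have "\<dots> = (\<Sum>k\<le>Suc j. (1 - q ^ (Suc j - k)) * t k (Suc j - k))
               + (\<Sum>k\<le>Suc j. q ^ (Suc j - k) * ((1 - q ^ k) * t k (Suc j - k)))"
    by (rule sum.distrib)
  also have "(\<Sum>k\<le>Suc j. (1 - q ^ (Suc j - k)) * t k (Suc j - k)) = (\<Sum>k\<le>j. t k (j - k))"
    using lower_i by (simp add: Suc_diff_le del: power_Suc)
  also have "(\<Sum>k\<le>Suc j. q ^ (Suc j - k) * ((1 - q ^ k) * t k (Suc j - k)))
           = (\<Sum>k\<le>j. q ^ (j - k) * (- z * q ^ k * t k (j - k)))"
    unfolding sum.atMost_Suc_shift using lower_k by (simp del: power_Suc)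
  also have "\<dots> = - z * q ^ j * (\<Sum>k\<le>j. t k (j - k))"
    unfolding sum_distrib_left
  proof (rule sum.cong)
    fix k assume "k \<in> {..j}"
    then have "q ^ j = q ^ (j - k) * q ^ k"
      by (simp flip: power_add)
    then show "q ^ (j - k) * (- z * q ^ k * t k (j - k)) = - z * q ^ j * t k (j - k)"
      by simp
  qed simp
  finally have "(1 - q ^ Suc j) * (\<Sum>k\<le>Suc j. t k (Suc j - k))
              = (1 - z * q ^ j) * (\<Sum>k\<le>j. t k (j - k))"
    by (simp add: algebra_simps)
  also have "(\<Sum>k\<le>j. t k (j - k)) = qpoch z q j / qpoch q q j"
    using Suc.IH by (simp add: t_def)
  finally have "(\<Sum>k\<le>Suc j. t k (Suc j - k))
              = (1 - z * q ^ j) * (qpoch z q j / qpoch q q j) / (1 - q ^ Suc j)"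
    using nz[of j] by (subst nonzero_eq_divide_eq) (simp_all only: power_Suc mult.commute not_False_eq_True)
  then show ?case
    by (simp add: t_def qpoch_Suc mult.commute del: sum.atMost_Suc)
qed

text \<open>
  The exponent \<open>(k choose 2) + 2 k\<close> is \<open>k\<^sup>2/2 + 3k/2\<close>; one of the two factors \<open>q\<^sup>k\<close> completes the \<open>q\<^sup>i\<close>
  of the inner polynomial to \<open>q\<^bsup>k+i\<^esup>\<close>, the other turns \<open>a b q\<^sup>n\<close> into \<open>a b q\<^bsup>n+1\<^esup>\<close>.
\<close>

lemma big_q_jacobi_as_laguerre_sum:
  fixes q a b c x :: "'a::field"
  assumes "q \<noteq> 0" and not_root: "\<And>m. m > 0 \<Longrightarrow> q ^ m \<noteq> 1"
  shows "(\<Sum>k = 0..n.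
            qpochs [q powi (- int n), x] q k / qpochs [q, a * q, c * q] q k
            * (- (a * b * q ^ n)) ^ k * q ^ ((k choose 2) + 2 * k)
            * big_q_jacobi (n - k) (x * q ^ k) (a * q ^ k) 0 (c * q ^ k) q)
         = big_q_jacobi n x a b c q"
proof -
  define z where "z = a * b * q ^ (n + 1)"
  define w where "w j = qpoch (q powi (- int n)) q j * qpoch x q j
      / (qpoch (a * q) q j * qpoch (c * q) q j) * q ^ j" for j
  define t where "t k i = (- z) ^ k * q ^ (k choose 2) / (qpoch q q k * qpoch q q i)" for k i
  have merge: "qpochs [q powi (- int n), x] q k / qpochs [q, a * q, c * q] q k
        * (- (a * b * q ^ n)) ^ k * q ^ ((k choose 2) + 2 * k)
        * (qpochs [q powi (- int (n - k)), (a * q ^ k) * 0 * q ^ (n - k + 1), x * q ^ k] q i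
           / qpochs [a * q ^ k * q, c * q ^ k * q, q] q i * q ^ i)
      = w (k + i) * t k i" if "k \<le> n" for k i
  proof -
    have shift: "q powi (- int (n - k)) = q powi (- int n) * q ^ k"
      using that \<open>q \<noteq> 0\<close>
      by (simp add: power_int_minus power_diff field_simps del: of_nat_diff)
    have z_power: "(- z) ^ k = (- (a * b * q ^ n)) ^ k * q ^ k"
      by (simp add: z_def ac_simps flip: power_mult_distrib)
    have q_power: "q ^ ((k choose 2) + 2 * k) = q ^ (k choose 2) * q ^ k * q ^ k"
      by (simp add: power_add mult_2)
    show ?thesis
      unfolding w_def t_def shift z_power q_power qpoch_add power_add[of q k i]
      by (simp add: qpochs_def divide_inverse ac_simps)
  qed
  have "(\<Sum>k = 0..n.
            qpochs [q powi (- int n), x] q k / qpochs [q, a * q, c * q] q k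
            * (- (a * b * q ^ n)) ^ k * q ^ ((k choose 2) + 2 * k)
            * big_q_jacobi (n - k) (x * q ^ k) (a * q ^ k) 0 (c * q ^ k) q)
      = (\<Sum>k\<le>n. \<Sum>i\<le>n - k. w (k + i) * t k i)"
    unfolding big_q_jacobi_def sum_distrib_left atMost_atLeast0
    by (intro sum.cong refl merge) simp
  also have "\<dots> = (\<Sum>(k, i)\<in>(SIGMA k:{..n}. {..n - k}). w (k + i) * t k i)"
    by (simp add: sum.Sigma)
  also have "(SIGMA k:{..n}. {..n - k}) = {(k, i). k + i \<le> n}"
    by auto
  also have "(\<Sum>(k, i)\<in>{(k, i). k + i \<le> n}. w (k + i) * t k i)
           = (\<Sum>j\<le>n. \<Sum>k\<le>j. w (k + (j - k)) * t k (j - k))"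
    by (rule sum.triangle_reindex_eq)
  also have "\<dots> = (\<Sum>j\<le>n. w j * (\<Sum>k\<le>j. t k (j - k)))"
    by (simp add: sum_distrib_left)
  also have "\<dots> = (\<Sum>j\<le>n. w j * (qpoch z q j / qpoch q q j))"
    unfolding t_def using q_binomial[OF not_root] by simp
  also have "\<dots> = big_q_jacobi n x a b c q"
    unfolding big_q_jacobi_def atMost_atLeast0
    by (intro sum.cong refl) (simp add: w_def z_def qpochs_def divide_inverse ac_simps)
  finally show ?thesis .
qed

lemma powr_quadratic_exponent:
  fixes q :: real
  assumes "0 < q"
  shows "q powr (1 / 2 * real k ^ 2 + 3 / 2 * real k) = q ^ ((k choose 2) + 2 * k)"
proof -
  have "real (k choose 2) = real k * (real k - 1) / 2"
    by (induction k) (simp_all add: numeral_2_eq_2 field_simps)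
  then have "1 / 2 * real k ^ 2 + 3 / 2 * real k = real ((k choose 2) + 2 * k)"
    by (simp add: power2_eq_square field_simps)
  then show ?thesis
    using assms by (simp only: powr_realpow)
qed

theorem mainTheorem13:
  fixes q a b c :: real and n :: nat and x :: "'a::real_field"
  assumes "0 < q" and "q < 1"
    and "0 < a" and "a < inverse q"
    and "0 < b" and "b < inverse q"
    and "c < 0"
  shows "(\<Sum>k = 0..n.
           qpochs [of_real (q powi (- int n)), x] (of_real q) k
           / qpochs [of_real q, of_real (a * q), of_real (c * q)] (of_real q) k
           * of_real ((- (a * b * q ^ n)) ^ k)
           * of_real (q powr (1 / 2 * real k ^ 2 + 3 / 2 * real k))
           * big_q_jacobi (n - k) (x * of_real (q ^ k))
               (of_real (a * q ^ k)) 0 (of_real (c * q ^ k)) (of_real q))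
         = big_q_jacobi n x (of_real a) (of_real b) (of_real c) (of_real q)"
proof -
  have "(of_real q :: 'a) ^ m \<noteq> 1" if "m > 0" for m
  proof -
    have "q ^ m < 1"
      using assms(1,2) that by (simp add: power_less_one_iff)
    then have "of_real (q ^ m) \<noteq> (1 :: 'a)"
      unfolding of_real_eq_1_iff by simp
    then show ?thesis
      by simp
  qed
  moreover have "(of_real q :: 'a) \<noteq> 0"
    using assms(1) by simp
  ultimately show ?thesis
    unfolding powr_quadratic_exponent[OF assms(1)] of_real_power of_real_mult of_real_minus
      of_real_power_int
    by (intro big_q_jacobi_as_laguerre_sum)
qed

end
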